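(* Let $T$ be a real task with raw submission set $\Omega$, admissible submission set $\Pi\subseteq\Omega$ and evaluator $E_T:\Omega\to\mathbb{R}^d$. Let $\Pi_{\mathrm{AI}}(T)\subseteq\Pi$ be a finite nonempty declared AI-native baseline with AI-native Pareto frontier $F_{\mathrm{AI}}(T)$, let $r\in\mathbb{R}^d$ be the reference point, and assume that all scores involved (the scores $E_T(\pi)$ of admissible submissions, hence also the points of $F_{\mathrm{AI}}(T)$, and the scores in $S_H^\Gamma(T;\sigma)$) lie in a fixed bounded nonfailing score box strictly above $r$, i.e. every point $x$ of the box satisfies $r_i<x_i$ for all $i=1,\dots,d$. Then for every admissible submission $\pi\in\Pi$, \[ \delta_T(\pi)>0\quad\Longleftrightarrow\quad E_T(\pi)\notin\operatorname{Down}(F_{\mathrm{AI}}(T)). \] Consequently, for every candidate skill $\sigma$ evaluated through a finite assessment protocol $\Gamma$, with finite set of score vectors $S_H^\Gamma(T;\sigma)$, \[ \Delta_T^\Gamma(\sigma)>0\quad\Longleftrightarrow\quad \exists\, s\in S_H^\Gamma(T;\sigma)\ \text{such that}\ s\notin\operatorname{Down}(F_{\mathrm{AI}}(T)). \]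
   Context: Let $d\ge 1$. For $x,y\in\mathbb{R}^d$, $x\preceq y$ means $x_i\le y_i$ for every $i$; $x\prec y$ means $x\preceq y$ and $x_j<y_j$ for at least one $j$. For a finite set $S\subset\mathbb{R}^d$, the Pareto frontier is $\operatorname{PF}(S)=\{s\in S:\text{there is no } s'\in S \text{ with } s\prec s'\}$. For $F\subseteq\mathbb{R}^d$, $\operatorname{Down}(F)=\{x\in\mathbb{R}^d:\exists y\in F \text{ with } x\preceq y\}$. For a finite set $F\subset\mathbb{R}^d$ and $r\in\mathbb{R}^d$, the dominated hypervolume is \[ \operatorname{HV}(F;r)=\lambda_d\Big(\bigcup_{s\in F}[r_1,s_1]\times\cdots\times[r_d,s_d]\Big), \] with $\lambda_d$ Lebesgue measure on $\mathbb{R}^d$. Real task (abstractly): a set $\Omega$ of raw submissions, a subset $\Pi\subseteq\Omega$ of admissible submissions, and a total evaluator $E_T:\Omega\to\mathbb{R}^d$ (larger coordinates are better), equal to a fixed failing score on $\Omega\setminus\Pi$. AI-native baseline: a finite nonempty set $\Pi_{\mathrm{AI}}(T)\subseteq\Pi$. Its score set is $S_{\mathrm{AI}}(T)=\{E_T(\pi):\pi\in\Pi_{\mathrm{AI}}(T)\}$ and the AI-native Pareto frontier is $F_{\mathrm{AI}}(T)=\operatorname{PF}(S_{\mathrm{AI}}(T))$. Pareto surplus of an admissible $\pi\in\Pi$: $\delta_T(\pi)=\operatorname{HV}(F_{\mathrm{AI}}(T)\cup\{E_T(\pi)\};r)-\operatorname{HV}(F_{\mathrm{AI}}(T);r)$.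 Skill and protocol: for a skill $\sigma$ and finite assessment protocol $\Gamma$, the only mathematical datum is a finite set $S_H^\Gamma(T;\sigma)\subset\mathbb{R}^d$ of score vectors, and \[ \Delta_T^\Gamma(\sigma)=\operatorname{HV}(F_{\mathrm{AI}}(T)\cup S_H^\Gamma(T;\sigma);r)-\operatorname{HV}(F_{\mathrm{AI}}(T);r). \] *)

theory Defs
  imports "HOL-Analysis.Analysis"
begin

text \<open>
  Score vectors live in \<^typ>\<open>real ^ 'n\<close>, whose library order is the componentwise one.
  The following two facts spell out that \<open>\<le>\<close> is weak dominance and that \<open><\<close> is Pareto
  dominance (weakly below in every coordinate, strictly below in at least one; it is
  not strictness in all coordinates).
\<close>

lemma weak_dominance_iff:
  fixes x y :: "real ^ 'n"
  shows "x \<le> y \<longleftrightarrow> (\<forall>i. x $ i \<le> y $ i)"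
  by (simp add: less_eq_vec_def)

lemma pareto_dominance_iff:
  fixes x y :: "real ^ 'n"
  shows "x < y \<longleftrightarrow> (\<forall>i. x $ i \<le> y $ i) \<and> (\<exists>j. x $ j < y $ j)"
  by (auto simp: less_vec_def less_eq_vec_def not_le)

definition PF :: "(real ^ 'n) set \<Rightarrow> (real ^ 'n) set" where
  "PF S = {s \<in> S. \<not> (\<exists>s'\<in>S. s < s')}"

definition Down :: "(real ^ 'n) set \<Rightarrow> (real ^ 'n) set" where
  "Down F = {x. \<exists>y\<in>F. x \<le> y}"

text \<open>
  \<open>cbox r s\<close> is the product of the intervals \<open>[r $ i, s $ i]\<close>, and is empty as soon as one of
  them is. For finite \<open>F\<close> the union is compact, so its measure is finite and the
  real-valued \<^const>\<open>measure\<close> loses no information.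
\<close>

definition HV :: "(real ^ 'n) set \<Rightarrow> real ^ 'n \<Rightarrow> real" where
  "HV F r = measure lebesgue (\<Union>s\<in>F. cbox r s)"

definition AI_frontier :: "('w \<Rightarrow> real ^ 'n) \<Rightarrow> 'w set \<Rightarrow> (real ^ 'n) set" where
  "AI_frontier E Base = PF (E ` Base)"

definition pareto_surplus ::
    "('w \<Rightarrow> real ^ 'n) \<Rightarrow> 'w set \<Rightarrow> real ^ 'n \<Rightarrow> 'w \<Rightarrow> real" where
  "pareto_surplus E Base r \<pi> =
     HV (AI_frontier E Base \<union> {E \<pi>}) r - HV (AI_frontier E Base) r"

text \<open>\<open>SH\<close> is the set of score vectors that a skill attains under an assessment protocol.\<close>

definition skill_surplus ::
    "('w \<Rightarrow> real ^ 'n) \<Rightarrow> 'w set \<Rightarrow> real ^ 'n \<Rightarrow> (real ^ 'n) set \<Rightarrow> real" where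
  "skill_surplus E Base r SH =
     HV (AI_frontier E Base \<union> SH) r - HV (AI_frontier E Base) r"

end

theory Submission
  imports Defs
begin

text \<open>
  Points of \<open>Down F\<close> contribute boxes already contained in the region dominated by \<open>F\<close>. Conversely,
  if \<open>s\<close> is outside \<open>Down F\<close> then \<open>s\<close> misses that region, which is closed; since \<open>s\<close> lies in the
  closure of the open box below it, a nonempty open part of this box is newly dominated, and
  nonempty open sets have positive measure.
\<close>

lemma Union_cbox_lmeasurable:
  fixes r :: "'a::euclidean_space"
  assumes "finite F"
  shows "(\<Union>s\<in>F. cbox r s) \<in> lmeasurable"
  using assms by (intro fmeasurable.finite_UN) auto

text \<open>All boxes share the lower corner \<open>r\<close>, so raising the upper corner only
  enlarges a box: if \<open>s \<le> y\<close>, then \<open>cbox r s\<close> lies inside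
  \<open>cbox r y\<close>.\<close>

lemma Union_cbox_Un_Down:
  assumes "S \<subseteq> Down F"
  shows "(\<Union>s\<in>F \<union> S. cbox r s) = (\<Union>s\<in>F. cbox r s)"
proof -
  have "\<exists>y\<in>F. cbox r s \<subseteq> cbox r y" if s: "s \<in> S" for s
  proof -
    obtain y where "y \<in> F" "s \<le> y"
      using assms s unfolding Down_def by blast
    then have "cbox r s \<subseteq> cbox r y"
      by (auto simp: subset_interval_cart less_eq_vec_def)
    with \<open>y \<in> F\<close> show ?thesis ..
  qed
  then show ?thesis by blast
qed

lemma HV_Un_greater:
  fixes r s :: "real ^ 'n"
  assumes "finite F" "finite S" "s \<in> S" "s \<notin> Down F" and above: "\<And>i. r $ i < s $ i"
  shows "HV F r < HV (F \<union> S) r"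
proof -
  let ?A = "\<Union>y\<in>F. cbox r y" and ?B = "\<Union>y\<in>F \<union> S. cbox r y"
  have A: "?A \<in> lmeasurable" and B: "?B \<in> lmeasurable"
    using assms by (simp_all only: Union_cbox_lmeasurable finite_Un)
  have "closed ?A"
    using \<open>finite F\<close> by (intro closed_UN) auto
  \<comment> \<open>Membership of \<open>s\<close> in some \<open>cbox r y\<close> would give
    \<open>s \<le> y\<close>, putting \<open>s\<close> in \<open>Down F\<close>.\<close>
  have "s \<notin> ?A"
    using \<open>s \<notin> Down F\<close> by (auto simp: Down_def mem_box_cart less_eq_vec_def)
  \<comment> \<open>Strictness in every coordinate enters here: if \<open>r\<close> and
    \<open>s\<close> agreed in one coordinate, the box would be flat and of measure zero.\<close>
  have "box r s \<noteq> {}"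
    using above by (simp add: interval_ne_empty_cart)
  then have "s \<in> closure (box r s)"
    using above by (simp add: closure_box mem_box_cart less_imp_le)
  \<comment> \<open>An open set that meets the closure of a set, here at \<open>s\<close>, meets the
    set itself.\<close>
  with \<open>closed ?A\<close> \<open>s \<notin> ?A\<close> have "- ?A \<inter> box r s \<noteq> {}"
    using open_Int_closure_eq_empty[of "- ?A" "box r s"] unfolding closed_def by blast
  moreover have "open (- ?A \<inter> box r s)"
    using \<open>closed ?A\<close> open_Compl open_Int open_box by blast
  ultimately have "\<not> negligible (- ?A \<inter> box r s)"
    by (rule open_not_negligible[rotated])
  moreover have "- ?A \<inter> box r s \<subseteq> ?B - ?A"
    using \<open>s \<in> S\<close> box_subset_cbox[of r s] by blast
  ultimately have "\<not> negligible (?B - ?A)"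
    using negligible_subset by blast
  \<comment> \<open>The difference has finite measure, so a zero value of \<open>measure\<close>
    could only mean that it is negligible.\<close>
  then have "measure lebesgue (?B - ?A) > 0"
    using A B negligible_iff_measure[of "?B - ?A"] fmeasurable.Diff[OF B A]
    by (simp add: zero_less_measure_iff)
  moreover have "measure lebesgue (?B - ?A) = measure lebesgue ?B - measure lebesgue ?A"
    using A B by (intro measurable_measure_Diff fmeasurableD) auto
  ultimately show ?thesis
    by (simp add: HV_def)
qed

text \<open>A finite set \<open>S\<close> covers both claims of the theorem:
  \<open>{E \<pi>}\<close> for one submission, \<open>SH \<Gamma> \<sigma>\<close> for a
  skill.\<close>

lemma HV_Un_greater_iff:
  fixes r :: "real ^ 'n"
  assumes "finite F" "finite S" and above: "\<And>s i. s \<in> S \<Longrightarrow> r $ i < s $ i"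
  shows "HV F r < HV (F \<union> S) r \<longleftrightarrow> (\<exists>s\<in>S. s \<notin> Down F)"
proof
  assume "HV F r < HV (F \<union> S) r"
  \<comment> \<open>By contraposition: if \<open>S \<subseteq> Down F\<close>, both unions of boxes
    coincide and the volumes are equal.\<close>
  then show "\<exists>s\<in>S. s \<notin> Down F"
    using Union_cbox_Un_Down[of S F r] by (force simp: HV_def)
qed (use assms HV_Un_greater in blast)

lemma finite_AI_frontier: "finite Base \<Longrightarrow> finite (AI_frontier E Base)"
  by (simp add: AI_frontier_def PF_def)

theorem theorem1:
  fixes \<Omega> Adm Base :: "'w set"
    and E :: "'w \<Rightarrow> real ^ 'n"
    and fail r :: "real ^ 'n"
    and B :: "(real ^ 'n) set"
    and SH :: "'protocol \<Rightarrow> 'skill \<Rightarrow> (real ^ 'n) set"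
  assumes admissible: "Adm \<subseteq> \<Omega>"
    and failing: "\<forall>\<omega>\<in>\<Omega> - Adm. E \<omega> = fail"
    and baseline: "Base \<subseteq> Adm" "finite Base" "Base \<noteq> {}"
    and box: "is_interval B" "bounded B" "fail \<notin> B"
    and above_ref: "\<forall>x\<in>B. \<forall>i. r $ i < x $ i"
    and scores: "\<forall>\<pi>\<in>Adm. E \<pi> \<in> B"
  shows "(\<forall>\<pi>\<in>Adm. pareto_surplus E Base r \<pi> > 0 \<longleftrightarrow> E \<pi> \<notin> Down (AI_frontier E Base))
    \<and> (\<forall>\<Gamma> \<sigma>. finite (SH \<Gamma> \<sigma>) \<longrightarrow> SH \<Gamma> \<sigma> \<subseteq> B \<longrightarrow>
          (skill_surplus E Base r (SH \<Gamma> \<sigma>) > 0 \<longleftrightarrow>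
            (\<exists>s\<in>SH \<Gamma> \<sigma>. s \<notin> Down (AI_frontier E Base))))"
proof (intro conjI ballI allI impI)
  have fin: "finite (AI_frontier E Base)"
    using baseline(2) by (rule finite_AI_frontier)
  show "pareto_surplus E Base r \<pi> > 0 \<longleftrightarrow> E \<pi> \<notin> Down (AI_frontier E Base)" if "\<pi> \<in> Adm" for \<pi>
    using HV_Un_greater_iff[OF fin, of "{E \<pi>}" r] above_ref scores that
    by (simp add: pareto_surplus_def)
  show "skill_surplus E Base r (SH \<Gamma> \<sigma>) > 0 \<longleftrightarrow> (\<exists>s\<in>SH \<Gamma> \<sigma>. s \<notin> Down (AI_frontier E Base))"
    if "finite (SH \<Gamma> \<sigma>)" "SH \<Gamma> \<sigma> \<subseteq> B" for \<Gamma> \<sigma>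
    using HV_Un_greater_iff[OF fin that(1), of r] above_ref that(2)
    by (auto simp: skill_surplus_def subset_iff)
qed

end
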